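(* Let $V$ be a finite set, $m\ge1$, $\lambda\in(0,1)$, $\bar\lambda=1-\lambda$, and let $f_1,\dots,f_m:2^V\to\mathbb{R}$ be normalized, monotone non-decreasing, submodular functions. (a) Let $\alpha\le1$ and $\beta\le1$ be the approximation factors of \textsc{AlgWC} for $\max_\pi \min_i f_i(A_i^\pi)$ and \textsc{AlgAC} for $\max_\pi\frac1m\sum_i f_i(A_i^\pi)$, respectively. Then the scheme CombSfaSwp returns a partition $\hat\pi$ with $\bar\lambda\min_i f_i(A_i^{\hat\pi})+\frac{\lambda}{m}\sum_j f_j(A_j^{\hat\pi})\ge \rho\cdot\max_{\pi\in\Pi}\big[\bar\lambda\min_i f_i(A_i^{\pi})+\frac{\lambda}{m}\sum_j f_j(A_j^{\pi})\big]$, where $\rho=\max\{\frac{\beta\alpha}{\bar\lambda\beta+\alpha},\lambda\beta\}$ in general (heterogeneous case) and $\rho=\max\{\min\{\alpha,\frac1m\},\frac{\beta\alpha}{\bar\lambda\beta+\alpha},\lambda\beta\}$ when $f_1=\dots=f_m$ (homogeneous case). (b) Let $\alpha\ge1$ and $\beta\ge1$ be the approximation factors of \textsc{AlgWC} for $\min_\pi\max_i f_i(A_i^\pi)$ and \textsc{AlgAC} for $\min_\pi\frac1m\sum_i f_i(A_i^\pi)$, respectively. Then the scheme CombSlbSmp returns a partition $\hat\pi$ with $\bar\lambda\max_i f_i(A_i^{\hat\pi})+\frac{\lambda}{m}\sum_j f_j(A_j^{\hat\pi})\le \rho'\cdot\min_{\pi\in\Pi}\big[\bar\lambda\max_i f_i(A_i^{\pi})+\frac{\lambda}{m}\sum_j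 f_j(A_j^{\pi})\big]$, where $\rho'=\min\{\frac{m\alpha}{m\bar\lambda+\lambda},\beta(m\bar\lambda+\lambda)\}$ in general (heterogeneous case) and $\rho'=\min\{m,\frac{m\alpha}{m\bar\lambda+\lambda},\beta(m\bar\lambda+\lambda)\}$ when $f_1=\dots=f_m$ (homogeneous case).
   Context: $f$ is normalized if $f(\emptyset)=0$, monotone non-decreasing if $f(S)\le f(T)$ for $S\subseteq T$, submodular if $f(S)+f(T)\ge f(S\cup T)+f(S\cap T)$. $\Pi$ is the set of ordered partitions $\pi=(A_1^\pi,\dots,A_m^\pi)$ of $V$ into $m$ pairwise disjoint (possibly empty) blocks covering $V$. For a maximization problem, an algorithm has approximation factor $\alpha\le1$ if its output value is at least $\alpha$ times the optimum; for a minimization problem, factor $\alpha\ge1$ if its output value is at most $\alpha$ times the optimum. CombSfaSwp: run \textsc{AlgWC} to get $\hat\pi_1$ and \textsc{AlgAC} to get $\hat\pi_2$, and output whichever of $\hat\pi_1,\hat\pi_2$ has the larger value of $\bar\lambda\min_i f_i(A_i^\pi)+\frac{\lambda}{m}\sum_j f_j(A_j^\pi)$. CombSlbSmp: run \textsc{AlgWC} (for the max-block minimization) to get $\hat\pi_1$ and \textsc{AlgAC} (for the average minimization) to get $\hat\pi_2$, and output whichever has the smaller value of $\bar\lambda\max_i f_i(A_i^\pi)+\frac{\lambda}{m}\sum_j f_j(A_j^\pi)$.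
   Formalization: In part (a) the approximation factors α and β are additionally assumed nonnegative (0 ≤ α, β ≤ 1), since for negative α the bound βα/(λ̄β+α) can exceed 1 and the claim fails; at α = β = 0 this fraction is read as 0. *)

theory Defs
  imports Complex_Main "HOL-Library.FuncSet" "HOL-Library.Disjoint_Sets"
begin

definition normalized :: "('a set \<Rightarrow> real) \<Rightarrow> bool" where
  "normalized g \<longleftrightarrow> g {} = 0"

definition submodular_on :: "'a set \<Rightarrow> ('a set \<Rightarrow> real) \<Rightarrow> bool" where
  "submodular_on V g \<longleftrightarrow>
     (\<forall>S T. S \<subseteq> V \<longrightarrow> T \<subseteq> V \<longrightarrow> g (S \<union> T) + g (S \<inter> T) \<le> g S + g T)"

text \<open>Blocks are indexed by \<open>{1..m}\<close>; taking extensional functions makes each ordered partition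
  a unique object, so there are finitely many of them when \<open>V\<close> is finite.\<close>

definition ordered_partitions :: "'a set \<Rightarrow> nat \<Rightarrow> (nat \<Rightarrow> 'a set) set" where
  "ordered_partitions V m =
     {A \<in> {1..m} \<rightarrow>\<^sub>E Pow V. disjoint_family_on A {1..m} \<and> (\<Union>i\<in>{1..m}. A i) = V}"

definition min_block :: "nat \<Rightarrow> (nat \<Rightarrow> 'a set \<Rightarrow> real) \<Rightarrow> (nat \<Rightarrow> 'a set) \<Rightarrow> real" where
  "min_block m f A = Min ((\<lambda>i. f i (A i)) ` {1..m})"

definition max_block :: "nat \<Rightarrow> (nat \<Rightarrow> 'a set \<Rightarrow> real) \<Rightarrow> (nat \<Rightarrow> 'a set) \<Rightarrow> real" where
  "max_block m f A = Max ((\<lambda>i. f i (A i)) ` {1..m})"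

definition avg_block :: "nat \<Rightarrow> (nat \<Rightarrow> 'a set \<Rightarrow> real) \<Rightarrow> (nat \<Rightarrow> 'a set) \<Rightarrow> real" where
  "avg_block m f A = 1 / real m * (\<Sum>i=1..m. f i (A i))"

definition mixed_min :: "real \<Rightarrow> nat \<Rightarrow> (nat \<Rightarrow> 'a set \<Rightarrow> real) \<Rightarrow> (nat \<Rightarrow> 'a set) \<Rightarrow> real" where
  "mixed_min lam m f A = (1 - lam) * min_block m f A + lam / real m * (\<Sum>j=1..m. f j (A j))"

definition mixed_max :: "real \<Rightarrow> nat \<Rightarrow> (nat \<Rightarrow> 'a set \<Rightarrow> real) \<Rightarrow> (nat \<Rightarrow> 'a set) \<Rightarrow> real" where
  "mixed_max lam m f A = (1 - lam) * max_block m f A + lam / real m * (\<Sum>j=1..m. f j (A j))"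

text \<open>An algorithm maps an instance, consisting of the ground set, the number of blocks and the
  functions \<open>f\<^sub>1, \<dots>, f\<^sub>m\<close>, to its output.\<close>

type_synonym 'a partition_alg =
  "'a set \<Rightarrow> nat \<Rightarrow> (nat \<Rightarrow> 'a set \<Rightarrow> real) \<Rightarrow> (nat \<Rightarrow> 'a set)"

type_synonym 'a objective =
  "nat \<Rightarrow> (nat \<Rightarrow> 'a set \<Rightarrow> real) \<Rightarrow> (nat \<Rightarrow> 'a set) \<Rightarrow> real"

text \<open>The factor is attached to the instance at hand, so it may depend on \<open>V\<close>, \<open>m\<close> and \<open>f\<close>; a
  uniform guarantee over a class of instances yields the property for each of its members.\<close>

definition approx_factor_max ::
  "'a partition_alg \<Rightarrow> 'a objective \<Rightarrow> real \<Rightarrow> 'a set \<Rightarrow> nat \<Rightarrow> (nat \<Rightarrow> 'a set \<Rightarrow> real) \<Rightarrow> bool" where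
  "approx_factor_max alg obj \<alpha> V m f \<longleftrightarrow>
     alg V m f \<in> ordered_partitions V m \<and>
     obj m f (alg V m f) \<ge> \<alpha> * Max (obj m f ` ordered_partitions V m)"

definition approx_factor_min ::
  "'a partition_alg \<Rightarrow> 'a objective \<Rightarrow> real \<Rightarrow> 'a set \<Rightarrow> nat \<Rightarrow> (nat \<Rightarrow> 'a set \<Rightarrow> real) \<Rightarrow> bool" where
  "approx_factor_min alg obj \<alpha> V m f \<longleftrightarrow>
     alg V m f \<in> ordered_partitions V m \<and>
     obj m f (alg V m f) \<le> \<alpha> * Min (obj m f ` ordered_partitions V m)"

text \<open>Ties between the two candidates are broken arbitrarily.\<close>

definition CombSfaSwp :: "real \<Rightarrow> 'a partition_alg \<Rightarrow> 'a partition_alg \<Rightarrow> 'a partition_alg" where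
  "CombSfaSwp lam AlgWC AlgAC V m f =
     (ARG_MAX (mixed_min lam m f) A. A \<in> {AlgWC V m f, AlgAC V m f})"

definition CombSlbSmp :: "real \<Rightarrow> 'a partition_alg \<Rightarrow> 'a partition_alg \<Rightarrow> 'a partition_alg" where
  "CombSlbSmp lam AlgWC AlgAC V m f =
     (ARG_MIN (mixed_max lam m f) A. A \<in> {AlgWC V m f, AlgAC V m f})"

end

theory Submission imports Defs begin

text \<open>
  Write \<open>w\<close>, \<open>a\<close>, \<open>M\<close> for the minimum, average and maximum of the block values of a partition, so
  that \<open>0 \<le> w \<le> a \<le> M \<le> m a\<close>. Comparing the two candidates with an optimal partition of the mixed
  objective through these inequalities gives the heterogeneous factors; the first one in part (a)
  arises by adding the bounds \<open>w \<le> v / \<alpha>\<close> and \<open>\<lambda> a \<le> v / \<beta>\<close>, where \<open>w\<close> and \<open>a\<close> belong to the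
  optimal partition and \<open>v\<close> is the value returned. If all the functions equal \<open>g\<close>, then
  subadditivity and monotonicity place \<open>a\<close> between \<open>g V / m\<close> and \<open>g V\<close> for every partition.
\<close>

section \<open>Choosing the better of two candidates, and the best of several factors\<close>

lemma arg_max_doubleton:
  fixes h :: "'b \<Rightarrow> real" and a b :: 'b
  defines "x \<equiv> (ARG_MAX h z. z \<in> {a, b})"
  shows "x \<in> {a, b}" and "h a \<le> h x" and "h b \<le> h x"
proof -
  \<comment> \<open>The Hilbert choice behind \<open>ARG_MAX\<close> has its defining property only
    once some maximizer is exhibited. On a tie it may differ from this witness.\<close>
  have "is_arg_max h (\<lambda>z. z \<in> {a, b}) (if h a \<le> h b then b else a)"
    by (auto simp: is_arg_max_def)
  then have "is_arg_max h (\<lambda>z. z \<in> {a, b}) x"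
    unfolding x_def arg_max_def by (rule someI)
  then show "x \<in> {a, b}" "h a \<le> h x" "h b \<le> h x"
    by (auto simp: is_arg_max_linorder)
qed

lemma arg_min_doubleton:
  fixes h :: "'b \<Rightarrow> real" and a b :: 'b
  defines "x \<equiv> (ARG_MIN h z. z \<in> {a, b})"
  shows "x \<in> {a, b}" and "h x \<le> h a" and "h x \<le> h b"
proof -
  have "is_arg_min h (\<lambda>z. z \<in> {a, b}) (if h a \<le> h b then a else b)"
    by (auto simp: is_arg_min_def)
  then have "is_arg_min h (\<lambda>z. z \<in> {a, b}) x"
    unfolding x_def arg_min_def by (rule someI)
  then show "x \<in> {a, b}" "h x \<le> h a" "h x \<le> h b"
    by (auto simp: is_arg_min_linorder)
qed

text \<open>The maximum of a finite nonempty set is one of its elements, so bounds proved for each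
  factor separately give the bound for the best factor, whatever the sign of
  \<open>c\<close>.\<close>

lemma Max_times_le:
  fixes S :: "real set"
  assumes "finite S" and "S \<noteq> {}" and "\<forall>x\<in>S. x * c \<le> v"
  shows "Max S * c \<le> v"
  using Max_in[OF assms(1,2)] assms(3) by blast

lemma le_Min_times:
  fixes S :: "real set"
  assumes "finite S" and "S \<noteq> {}" and "\<forall>x\<in>S. v \<le> x * c"
  shows "v \<le> Min S * c"
  using Min_in[OF assms(1,2)] assms(3) by blast

section \<open>Ordered partitions, subadditivity and approximation guarantees\<close>

lemma finite_ordered_partitions:
  assumes "finite V"
  shows "finite (ordered_partitions V m)"
  unfolding ordered_partitions_def
  by (rule finite_subset[OF _ finite_PiE[of "{1..m}" "\<lambda>_. Pow V"]]) (use assms in auto)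

lemma ordered_partitions_block_subset:
  "A \<in> ordered_partitions V m \<Longrightarrow> i \<in> {1..m} \<Longrightarrow> A i \<subseteq> V"
  unfolding ordered_partitions_def by blast

lemma ordered_partitions_Union:
  "A \<in> ordered_partitions V m \<Longrightarrow> (\<Union>i\<in>{1..m}. A i) = V"
  unfolding ordered_partitions_def by blast

text \<open>Induction on \<open>I\<close>: submodularity is applied to the new block and the union
  of the others, and the intersection term is dropped, being nonnegative by monotonicity from
  \<open>g {} = 0\<close>.\<close>

lemma submodular_on_subadditive:
  assumes "finite I" and "submodular_on V g" and "normalized g" and "mono_on (Pow V) g"
    and "\<And>i. i \<in> I \<Longrightarrow> A i \<subseteq> V"
  shows "g (\<Union>i\<in>I. A i) \<le> (\<Sum>i\<in>I. g (A i))"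
  using assms(1,5)
proof (induction I rule: finite_induct)
  case empty
  then show ?case using assms(3) by (simp add: normalized_def)
next
  case (insert i I)
  let ?U = "\<Union>j\<in>I. A j"
  have sub: "A i \<subseteq> V" "?U \<subseteq> V" using insert.prems by blast+
  have "g {} \<le> g (A i \<inter> ?U)"
    by (rule mono_onD[OF assms(4)]) (use sub in auto)
  then have "0 \<le> g (A i \<inter> ?U)"
    using assms(3) by (simp add: normalized_def)
  moreover have "g (A i \<union> ?U) + g (A i \<inter> ?U) \<le> g (A i) + g ?U"
    using assms(2) sub unfolding submodular_on_def by blast
  moreover have "g ?U \<le> (\<Sum>j\<in>I. g (A j))"
    using insert by simp
  ultimately show ?case using insert.hyps by simp
qed

lemma min_block_le_avg_block:
  assumes "m \<ge> 1"
  shows "min_block m f A \<le> avg_block m f A"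
proof -
  have "of_nat (card {1..m}) * min_block m f A \<le> (\<Sum>i=1..m. f i (A i))"
    unfolding min_block_def by (intro sum_bounded_below) auto
  then show ?thesis using assms by (simp add: avg_block_def field_simps)
qed

lemma avg_block_le:
  assumes "m \<ge> 1" and "\<And>i. i \<in> {1..m} \<Longrightarrow> f i (A i) \<le> c"
  shows "avg_block m f A \<le> c"
proof -
  have "(\<Sum>i=1..m. f i (A i)) \<le> of_nat (card {1..m}) * c"
    using assms(2) by (rule sum_bounded_above)
  then show ?thesis using assms by (simp add: avg_block_def field_simps)
qed

lemma avg_block_le_max_block:
  "m \<ge> 1 \<Longrightarrow> avg_block m f A \<le> max_block m f A"
  by (rule avg_block_le) (auto simp: max_block_def)

lemma mixed_min_eq:
  "mixed_min lam m f A = (1 - lam) * min_block m f A + lam * avg_block m f A"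
  by (simp add: mixed_min_def avg_block_def)

lemma mixed_max_eq:
  "mixed_max lam m f A = (1 - lam) * max_block m f A + lam * avg_block m f A"
  by (simp add: mixed_max_def avg_block_def)

text \<open>Needed for an \<open>A\<close> that is optimal for the mixed objective rather than for
  \<open>obj\<close>; since \<open>\<alpha>\<close> is nonnegative, the guarantee against the
  maximum passes to every partition.\<close>

lemma approx_factor_maxD:
  assumes "approx_factor_max alg obj \<alpha> V m f" and "finite V" and "0 \<le> \<alpha>"
    and "A \<in> ordered_partitions V m"
  shows "alg V m f \<in> ordered_partitions V m" and "\<alpha> * obj m f A \<le> obj m f (alg V m f)"
proof -
  have "obj m f A \<le> Max (obj m f ` ordered_partitions V m)"
    using assms by (simp add: finite_ordered_partitions)
  then have "\<alpha> * obj m f A \<le> \<alpha> * Max (obj m f ` ordered_partitions V m)"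
    using assms(3) by (rule mult_left_mono)
  then show "alg V m f \<in> ordered_partitions V m" and "\<alpha> * obj m f A \<le> obj m f (alg V m f)"
    using assms(1) unfolding approx_factor_max_def by auto
qed

lemma approx_factor_minD:
  assumes "approx_factor_min alg obj \<alpha> V m f" and "finite V" and "0 \<le> \<alpha>"
    and "A \<in> ordered_partitions V m"
  shows "alg V m f \<in> ordered_partitions V m" and "obj m f (alg V m f) \<le> \<alpha> * obj m f A"
proof -
  have "Min (obj m f ` ordered_partitions V m) \<le> obj m f A"
    using assms by (simp add: finite_ordered_partitions)
  then have "\<alpha> * Min (obj m f ` ordered_partitions V m) \<le> \<alpha> * obj m f A"
    using assms(3) by (rule mult_left_mono)
  then show "alg V m f \<in> ordered_partitions V m" and "obj m f (alg V m f) \<le> \<alpha> * obj m f A"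
    using assms(1) unfolding approx_factor_min_def by auto
qed

section \<open>Inequalities between minimum, average and maximum block values\<close>

locale monotone_submodular_family =
  fixes V :: "'a set" and m :: nat and f :: "nat \<Rightarrow> 'a set \<Rightarrow> real"
  assumes fin: "finite V" and m_pos: "m \<ge> 1"
    and norm: "\<And>i. i \<in> {1..m} \<Longrightarrow> normalized (f i)"
    and mono: "\<And>i. i \<in> {1..m} \<Longrightarrow> mono_on (Pow V) (f i)"
    and submod: "\<And>i. i \<in> {1..m} \<Longrightarrow> submodular_on V (f i)"
begin

lemma block_nonneg:
  assumes "A \<in> ordered_partitions V m" and "i \<in> {1..m}"
  shows "0 \<le> f i (A i)"
proof -
  have "f i {} \<le> f i (A i)"
    by (rule mono_onD[OF mono]) (use assms ordered_partitions_block_subset[OF assms] in auto)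
  then show ?thesis using norm[OF assms(2)] by (simp add: normalized_def)
qed

lemma block_le_full:
  assumes "A \<in> ordered_partitions V m" and "i \<in> {1..m}"
  shows "f i (A i) \<le> f i V"
  by (rule mono_onD[OF mono]) (use assms ordered_partitions_block_subset[OF assms] in auto)

lemma min_block_nonneg:
  assumes "A \<in> ordered_partitions V m"
  shows "0 \<le> min_block m f A"
  unfolding min_block_def using m_pos block_nonneg[OF assms] by (subst Min_ge_iff) auto

lemma max_block_le_avg_block:
  assumes "A \<in> ordered_partitions V m"
  shows "max_block m f A \<le> real m * avg_block m f A"
proof -
  have "f i (A i) \<le> (\<Sum>i=1..m. f i (A i))" if "i \<in> {1..m}" for i
    using that block_nonneg[OF assms] by (intro member_le_sum) auto
  then have "max_block m f A \<le> (\<Sum>i=1..m. f i (A i))"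
    unfolding max_block_def using m_pos by (subst Max_le_iff) auto
  then show ?thesis using m_pos by (simp add: avg_block_def)
qed

text \<open>Subadditivity over the cover gives the first bound, monotonicity the second. As
  \<open>f 1 V\<close> does not depend on the partition, it lets any two partitions be compared. The
  functions agree only on subsets of \<open>V\<close>, hence the appeals to block inclusion.\<close>

lemma homogeneous_bounds:
  assumes hom: "\<forall>i\<in>{1..m}. \<forall>j\<in>{1..m}. \<forall>S. S \<subseteq> V \<longrightarrow> f i S = f j S"
    and A: "A \<in> ordered_partitions V m"
  shows "f 1 V \<le> real m * avg_block m f A" and "max_block m f A \<le> f 1 V"
proof -
  have one: "1 \<in> {1..m}" using m_pos by simp
  have sub: "\<And>i. i \<in> {1..m} \<Longrightarrow> A i \<subseteq> V"
    using A by (rule ordered_partitions_block_subset)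
  have "f 1 (\<Union>i\<in>{1..m}. A i) \<le> (\<Sum>i=1..m. f 1 (A i))"
    using sub by (intro submodular_on_subadditive[where V = V] submod norm mono one) auto
  also have "\<dots> = (\<Sum>i=1..m. f i (A i))"
    using hom one sub by (intro sum.cong) blast+
  finally show "f 1 V \<le> real m * avg_block m f A"
    unfolding ordered_partitions_Union[OF A] using m_pos by (simp add: avg_block_def)
  have "f i (A i) \<le> f 1 V" if "i \<in> {1..m}" for i
    using block_le_full[OF A that] hom one that by (metis order_refl)
  then show "max_block m f A \<le> f 1 V"
    unfolding max_block_def using m_pos by (subst Max_le_iff) auto
qed

section \<open>Factors of the two combined schemes against an arbitrary partition
  \<open>P\<close>\<close>

context
  fixes lam \<alpha> \<beta> :: real and AlgWC AlgAC :: "'a partition_alg"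
  assumes lam: "0 < lam" "lam < 1"
begin

lemma CombSfaSwp_bounds:
  assumes \<alpha>: "0 \<le> \<alpha>" and \<beta>: "0 \<le> \<beta>"
    and WC: "approx_factor_max AlgWC min_block \<alpha> V m f"
    and AC: "approx_factor_max AlgAC avg_block \<beta> V m f"
    and P: "P \<in> ordered_partitions V m"
  defines "A \<equiv> CombSfaSwp lam AlgWC AlgAC V m f"
  shows "A \<in> ordered_partitions V m"
    and "\<beta> * \<alpha> / ((1 - lam) * \<beta> + \<alpha>) * mixed_min lam m f P \<le> mixed_min lam m f A"
    and "lam * \<beta> * mixed_min lam m f P \<le> mixed_min lam m f A"
    and "\<forall>i\<in>{1..m}. \<forall>j\<in>{1..m}. \<forall>S. S \<subseteq> V \<longrightarrow> f i S = f j S \<Longrightarrow>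
      min \<alpha> (1 / real m) * mixed_min lam m f P \<le> mixed_min lam m f A"
proof -
  let ?X = "AlgWC V m f" and ?Y = "AlgAC V m f"
  let ?v = "mixed_min lam m f A" and ?w = "min_block m f" and ?a = "avg_block m f"
  note WC' = approx_factor_maxD[OF WC fin \<alpha> P] and AC' = approx_factor_maxD[OF AC fin \<beta> P]
  note arg = arg_max_doubleton[where h = "mixed_min lam m f" and a = ?X and b = ?Y,
      folded CombSfaSwp_def A_def]
  show A: "A \<in> ordered_partitions V m"
    using arg(1) WC'(1) AC'(1) by auto
  have wa: "?w B \<le> ?a B" for B
    using m_pos by (rule min_block_le_avg_block)
  have P0: "0 \<le> ?w P" "0 \<le> ?a P"
    using min_block_nonneg[OF P] wa[of P] by auto
  have lam_wa: "lam * ?w B \<le> lam * ?a B" for B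
    using wa lam by (intro mult_left_mono) auto
  \<comment> \<open>The mixed objective is a convex combination of minimum and average, so it is at
    least the minimum, which \<open>AlgWC\<close> controls.\<close>
  have "?w ?X \<le> mixed_min lam m f ?X"
    using lam_wa[of ?X] by (simp add: mixed_min_eq algebra_simps)
  then have v_w: "\<alpha> * ?w P \<le> ?v"
    using WC'(2) arg(2) by linarith
  \<comment> \<open>For the other candidate only the average is controlled, so the nonnegative
    minimum term is dropped; this costs the factor \<open>lam\<close>.\<close>
  have "lam * ?a ?Y \<le> mixed_min lam m f ?Y"
    using min_block_nonneg[OF AC'(1)] lam by (simp add: mixed_min_eq)
  moreover have "lam * (\<beta> * ?a P) \<le> lam * ?a ?Y"
    using AC'(2) lam by (intro mult_left_mono) auto
  ultimately have v_a: "lam * \<beta> * ?a P \<le> ?v"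
    using arg(3) by (simp add: algebra_simps)
  have "0 \<le> \<alpha> * ?w P"
    using \<alpha> P0 by simp
  with v_w have v0: "0 \<le> ?v" by linarith
  have "mixed_min lam m f P \<le> ?a P"
    using mult_left_mono[OF wa[of P], of "1 - lam"] lam by (simp add: mixed_min_eq algebra_simps)
  then have "lam * \<beta> * mixed_min lam m f P \<le> lam * \<beta> * ?a P"
    using lam \<beta> by (intro mult_left_mono) auto
  with v_a show "lam * \<beta> * mixed_min lam m f P \<le> ?v" by linarith
  show "\<beta> * \<alpha> / ((1 - lam) * \<beta> + \<alpha>) * mixed_min lam m f P \<le> ?v"
  \<comment> \<open>If either factor is zero, the fraction is zero, also when its denominator
    vanishes, and the claim becomes \<open>0 \<le> ?v\<close>.\<close>
  proof (cases "\<alpha> = 0 \<or> \<beta> = 0")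
    case True
    then show ?thesis using v0 by auto
  next
    case False
    then have pos: "0 < (1 - lam) * \<beta> + \<alpha>"
      using \<alpha> \<beta> lam by (intro add_nonneg_pos) auto
    \<comment> \<open>The weights \<open>\<beta> * (1 - lam)\<close> and \<open>\<alpha>\<close>
      make the two left sides add up to \<open>\<beta> * \<alpha>\<close> times the mixed value of
      \<open>P\<close>.\<close>
    have "\<beta> * (1 - lam) * (\<alpha> * ?w P) \<le> \<beta> * (1 - lam) * ?v"
      using v_w lam \<beta> by (intro mult_left_mono) auto
    moreover have "\<alpha> * (lam * \<beta> * ?a P) \<le> \<alpha> * ?v"
      using v_a \<alpha> by (rule mult_left_mono)
    ultimately have "\<beta> * \<alpha> * mixed_min lam m f P \<le> ?v * ((1 - lam) * \<beta> + \<alpha>)"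
      by (simp add: mixed_min_eq algebra_simps)
    with pos show ?thesis by (simp add: pos_divide_le_eq)
  qed
  show "min \<alpha> (1 / real m) * mixed_min lam m f P \<le> ?v"
    if hom: "\<forall>i\<in>{1..m}. \<forall>j\<in>{1..m}. \<forall>S. S \<subseteq> V \<longrightarrow> f i S = f j S"
  proof -
    let ?r = "min \<alpha> (1 / real m)"
    \<comment> \<open>The candidate of \<open>AlgWC\<close> handles both terms at once: its minimum
      is within \<open>\<alpha>\<close> of that of \<open>P\<close>, and its average, by comparison
      through \<open>f 1 V\<close>, within \<open>1 / real m\<close>.\<close>
    have "?a P \<le> f 1 V"
      using avg_block_le_max_block[OF m_pos] homogeneous_bounds(2)[OF hom P] by (rule order_trans)
    also have "\<dots> \<le> real m * ?a ?X"
      using homogeneous_bounds(1)[OF hom WC'(1)] .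
    finally have "1 / real m * ?a P \<le> ?a ?X"
      using m_pos by (simp add: field_simps)
    moreover have "?r * ?a P \<le> 1 / real m * ?a P"
      using P0 by (intro mult_right_mono) auto
    ultimately have "lam * (?r * ?a P) \<le> lam * ?a ?X"
      using lam by (intro mult_left_mono) linarith+
    moreover have "?r * ?w P \<le> \<alpha> * ?w P"
      using P0 by (intro mult_right_mono) auto
    then have "(1 - lam) * (?r * ?w P) \<le> (1 - lam) * ?w ?X"
      using WC'(2) lam by (intro mult_left_mono) linarith+
    moreover have "?r * mixed_min lam m f P = (1 - lam) * (?r * ?w P) + lam * (?r * ?a P)"
      by (simp add: mixed_min_eq distrib_left mult.left_commute)
    ultimately show ?thesis
      using arg(2) by (simp add: mixed_min_eq)
  qed
qed

lemma CombSlbSmp_bounds: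
  assumes \<alpha>: "0 \<le> \<alpha>" and \<beta>: "0 \<le> \<beta>"
    and WC: "approx_factor_min AlgWC max_block \<alpha> V m f"
    and AC: "approx_factor_min AlgAC avg_block \<beta> V m f"
    and P: "P \<in> ordered_partitions V m"
  defines "A \<equiv> CombSlbSmp lam AlgWC AlgAC V m f"
  shows "A \<in> ordered_partitions V m"
    and "mixed_max lam m f A \<le> real m * \<alpha> / (real m * (1 - lam) + lam) * mixed_max lam m f P"
    and "mixed_max lam m f A \<le> \<beta> * (real m * (1 - lam) + lam) * mixed_max lam m f P"
    and "\<forall>i\<in>{1..m}. \<forall>j\<in>{1..m}. \<forall>S. S \<subseteq> V \<longrightarrow> f i S = f j S \<Longrightarrow>
      mixed_max lam m f A \<le> real m * mixed_max lam m f P"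
proof -
  let ?X = "AlgWC V m f" and ?Y = "AlgAC V m f"
  let ?v = "mixed_max lam m f A" and ?M = "max_block m f" and ?a = "avg_block m f"
  let ?c = "real m * (1 - lam) + lam"
  note WC' = approx_factor_minD[OF WC fin \<alpha> P] and AC' = approx_factor_minD[OF AC fin \<beta> P]
  note arg = arg_min_doubleton[where h = "mixed_max lam m f" and a = ?X and b = ?Y,
      folded CombSlbSmp_def A_def]
  show A: "A \<in> ordered_partitions V m"
    using arg(1) WC'(1) AC'(1) by auto
  have aM: "?a B \<le> ?M B" for B
    using m_pos by (rule avg_block_le_max_block)
  have c: "0 < ?c" using lam by (intro add_nonneg_pos) auto
  have mixed_le: "mixed_max lam m f B \<le> ?M B" for B
    using mult_left_mono[OF aM[of B], of lam] lam by (simp add: mixed_max_eq algebra_simps)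
  have mixed_ge: "?a B \<le> mixed_max lam m f B" for B
    using mult_left_mono[OF aM[of B], of "1 - lam"] lam by (simp add: mixed_max_eq algebra_simps)
  \<comment> \<open>Bounding the maximum by \<open>m\<close> times the average inside the term
    weighted by \<open>lam\<close> makes the mixed value of \<open>P\<close> at least
    \<open>?c / real m\<close> times its maximum.\<close>
  have "lam * ?M P \<le> lam * (real m * ?a P)"
    using max_block_le_avg_block[OF P] lam by (intro mult_left_mono) auto
  then have "?c * ?M P \<le> real m * mixed_max lam m f P"
    by (simp add: mixed_max_eq algebra_simps)
  then have "\<alpha> * (?c * ?M P) \<le> \<alpha> * (real m * mixed_max lam m f P)"
    using \<alpha> by (rule mult_left_mono)
  then have "\<alpha> * ?M P \<le> real m * \<alpha> / ?c * mixed_max lam m f P"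
    using c by (simp add: pos_le_divide_eq mult_ac)
  then show "?v \<le> real m * \<alpha> / ?c * mixed_max lam m f P"
    using arg(2) mixed_le[of ?X] WC'(2) by linarith
  \<comment> \<open>The same inequality, now applied to the candidate of \<open>AlgAC\<close>,
    replaces its uncontrolled maximum by its average.\<close>
  have "(1 - lam) * ?M ?Y \<le> (1 - lam) * (real m * ?a ?Y)"
    using max_block_le_avg_block[OF AC'(1)] lam by (intro mult_left_mono) auto
  then have "mixed_max lam m f ?Y \<le> ?c * ?a ?Y"
    by (simp add: mixed_max_eq algebra_simps)
  also have "\<dots> \<le> ?c * (\<beta> * ?a P)"
    using AC'(2) c by (intro mult_left_mono) auto
  also have "\<dots> \<le> ?c * (\<beta> * mixed_max lam m f P)"
    using mixed_ge[of P] \<beta> c by (intro mult_left_mono) auto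
  finally show "?v \<le> \<beta> * ?c * mixed_max lam m f P"
    using arg(3) by (simp add: mult_ac)
  show "?v \<le> real m * mixed_max lam m f P"
    if hom: "\<forall>i\<in>{1..m}. \<forall>j\<in>{1..m}. \<forall>S. S \<subseteq> V \<longrightarrow> f i S = f j S"
  proof -
    \<comment> \<open>Whichever candidate is returned, its mixed value is at most its maximum block,
      hence at most \<open>f 1 V\<close>.\<close>
    have "?v \<le> f 1 V"
      using mixed_le homogeneous_bounds(2)[OF hom A] by (rule order_trans)
    also have "\<dots> \<le> real m * ?a P"
      using homogeneous_bounds(1)[OF hom P] .
    also have "\<dots> \<le> real m * mixed_max lam m f P"
      using mixed_ge by (intro mult_left_mono) auto
    finally show ?thesis .
  qed
qed

end

end

theorem theorem10:
  fixes V :: "'a set" and m :: nat and lam :: real and f :: "nat \<Rightarrow> 'a set \<Rightarrow> real"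
  assumes "finite V" and "m \<ge> 1" and "0 < lam" and "lam < 1"
    and "\<And>i. i \<in> {1..m} \<Longrightarrow> normalized (f i)"
    and "\<And>i. i \<in> {1..m} \<Longrightarrow> mono_on (Pow V) (f i)"
    and "\<And>i. i \<in> {1..m} \<Longrightarrow> submodular_on V (f i)"
  shows
    "(\<forall>(AlgWC :: 'a partition_alg) (AlgAC :: 'a partition_alg) (\<alpha> :: real) (\<beta> :: real).
        0 \<le> \<alpha> \<longrightarrow> \<alpha> \<le> 1 \<longrightarrow> 0 \<le> \<beta> \<longrightarrow> \<beta> \<le> 1 \<longrightarrow>
        approx_factor_max AlgWC min_block \<alpha> V m f \<longrightarrow>
        approx_factor_max AlgAC avg_block \<beta> V m f \<longrightarrow>
        (let A = CombSfaSwp lam AlgWC AlgAC V m f;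
             opt = Max (mixed_min lam m f ` ordered_partitions V m)
         in A \<in> ordered_partitions V m \<and>
            mixed_min lam m f A \<ge> Max {\<beta> * \<alpha> / ((1 - lam) * \<beta> + \<alpha>), lam * \<beta>} * opt \<and>
            ((\<forall>i\<in>{1..m}. \<forall>j\<in>{1..m}. \<forall>S. S \<subseteq> V \<longrightarrow> f i S = f j S) \<longrightarrow>
             mixed_min lam m f A \<ge>
               Max {min \<alpha> (1 / real m), \<beta> * \<alpha> / ((1 - lam) * \<beta> + \<alpha>), lam * \<beta>} * opt)))
     \<and>
     (\<forall>(AlgWC :: 'a partition_alg) (AlgAC :: 'a partition_alg) (\<alpha> :: real) (\<beta> :: real).
        1 \<le> \<alpha> \<longrightarrow> 1 \<le> \<beta> \<longrightarrow>
        approx_factor_min AlgWC max_block \<alpha> V m f \<longrightarrow>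
        approx_factor_min AlgAC avg_block \<beta> V m f \<longrightarrow>
        (let A = CombSlbSmp lam AlgWC AlgAC V m f;
             opt = Min (mixed_max lam m f ` ordered_partitions V m)
         in A \<in> ordered_partitions V m \<and>
            mixed_max lam m f A \<le>
              Min {real m * \<alpha> / (real m * (1 - lam) + lam), \<beta> * (real m * (1 - lam) + lam)} * opt \<and>
            ((\<forall>i\<in>{1..m}. \<forall>j\<in>{1..m}. \<forall>S. S \<subseteq> V \<longrightarrow> f i S = f j S) \<longrightarrow>
             mixed_max lam m f A \<le>
               Min {real m, real m * \<alpha> / (real m * (1 - lam) + lam),
                    \<beta> * (real m * (1 - lam) + lam)} * opt)))"
proof -
  interpret monotone_submodular_family V m f
    using assms by unfold_locales auto
  show ?thesis
  proof (intro conjI allI impI, goal_cases)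
    case (1 AlgWC AlgAC \<alpha> \<beta>)
    let ?Q = "mixed_min lam m f ` ordered_partitions V m"
    \<comment> \<open>The output of \<open>AlgWC\<close> shows that partitions exist, so the finite
      maximum is attained at some \<open>P\<close>, to which the bounds are applied.\<close>
    have "Max ?Q \<in> ?Q"
      using 1(5) assms(1)
      by (intro Max_in) (auto simp: approx_factor_max_def finite_ordered_partitions)
    then obtain P where P: "P \<in> ordered_partitions V m" "Max ?Q = mixed_min lam m f P"
      by blast
    note bounds = CombSfaSwp_bounds[OF assms(3,4) 1(1,3,5,6) P(1)]
    show ?case
      unfolding Let_def P(2)
      by (intro conjI impI bounds(1) Max_times_le) (use bounds(2-4) in blast)+
  next
    case (2 AlgWC AlgAC \<alpha> \<beta>)
    let ?Q = "mixed_max lam m f ` ordered_partitions V m"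
    have "Min ?Q \<in> ?Q"
      using 2(3) assms(1)
      by (intro Min_in) (auto simp: approx_factor_min_def finite_ordered_partitions)
    then obtain P where P: "P \<in> ordered_partitions V m" "Min ?Q = mixed_max lam m f P"
      by blast
    have "0 \<le> \<alpha>" "0 \<le> \<beta>" using 2(1,2) by auto
    note bounds = CombSlbSmp_bounds[OF assms(3,4) this 2(3,4) P(1)]
    show ?case
      unfolding Let_def P(2)
      by (intro conjI impI bounds(1) le_Min_times) (use bounds(2-4) in blast)+
  qed
qed

end
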